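(* For any integer $T\ge1$, the linear program $$p^T:=\sup_{\mu_0,\mu,\hat\mu,\nu,a}\int_{\mathbf{X}}\mu\quad\text{s.t. }\int_{\mathbf{X}}\nu+a=T\,\mathrm{vol}\,\mathbf{X},\ \ \mu+\nu=f_\#\nu+\mu_0,\ \ \mu+\hat\mu=\lambda_{\mathbf{X}},$$ with $\mu_0\in\mathcal{M}_+(\mathbf{X}^0)$, $\mu,\hat\mu,\nu\in\mathcal{M}_+(\mathbf{X})$, $a\in\mathbb{R}_+$, admits an optimal solution $(\mu_0^*,\mu^*,\hat\mu^*,\nu^*,a^* )$ such that $\mu^*=\lambda_{\mathbf{S}^T}$ for some set $\mathbf{S}^T$ satisfying $\mathbf{X}^T\subseteq\mathbf{S}^T\subseteq\bar{\mathbf{X}}^\infty$ and $\mathrm{vol}\,\mathbf{S}^T=p^T$. In addition, if $\lim_{T'\to\infty}\sum_{t=0}^{T'}t\,\mathrm{vol}\,\mathbf{Y}^t<\infty$, then there exists $T_0\in\mathbb{N}$ such that for all $T\ge T_0$ one has $\mathbf{S}^T=\bar{\mathbf{X}}^\infty$, the linear program has a unique optimal solution with $\mu^*=\lambda_{\mathbf{X}^\infty}$, and $p^T=\mathrm{vol}\,\mathbf{X}^\infty$.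
   Context: Let $\mathbf{X}^0=\{\mathbf{x}\in\mathbb{R}^n: g^0_1(\mathbf{x})\ge0,\dots,g^0_{m^0}(\mathbf{x})\ge0\}$ be compact with $g^0_j$ real polynomials, and let $f:\mathbb{R}^n\to\mathbb{R}^n$ be a polynomial map. Set $\mathbf{X}^T:=\mathbf{X}^0\cup f(\mathbf{X}^0)\cup\dots\cup f^T(\mathbf{X}^0)$ ($f^T$ is the $T$-fold composition) and $\mathbf{X}^\infty:=\lim_{T\to\infty}\mathbf{X}^T=\bigcup_T\mathbf{X}^T$ (the reachable set), with closure $\bar{\mathbf{X}}^\infty$. Set $\mathbf{Y}^0:=\mathbf{X}^0$ and $\mathbf{Y}^t:=f^t(\mathbf{X}^0)\setminus\mathbf{X}^{t-1}$ for $t\ge1$. Standing assumptions: (i) $\mathbf{X}^\infty\subseteq\mathbf{X}$, where $\mathbf{X}=\{\mathbf{x}\in\mathbb{R}^n: g_1(\mathbf{x})\ge0,\dots,g_m(\mathbf{x})\ge0\}$ is a given compact set with $g_j$ real polynomials (its Lebesgue moments are assumed known analytically); (ii) $\mathrm{vol}\,\mathbf{X}^\infty=\mathrm{vol}\,\bar{\mathbf{X}}^\infty$, where vol is Lebesgue volume; (iii) for large enough integers $N^0,N$, one of the $g^0_j$ equals $N^0-\|\mathbf{x}\|_2^2$ and one of the $g_j$ equals $N-\|\mathbf{x}\|_2^2$. $\mathcal{M}_+(\mathbf{A})$ is the cone of finite nonnegative Borel measures on the compact set $\mathbf{A}$. For $\mathbf{A}\subseteq\mathbf{X}$ Borel,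 $\lambda_{\mathbf{A}}(d\mathbf{x})=\mathbf{1}_{\mathbf{A}}(\mathbf{x})\,d\mathbf{x}$ is Lebesgue measure restricted to $\mathbf{A}$, with $\mathbf{1}_{\mathbf{A}}$ the indicator function of $\mathbf{A}$. For $\nu\in\mathcal{M}_+(\mathbf{X})$, the pushforward is $f_\#\nu(\mathbf{A}):=\nu(\{\mathbf{x}\in\mathbf{X}: f(\mathbf{x})\in\mathbf{A}\})$ for Borel $\mathbf{A}\subseteq\mathbf{X}$. Measures on $\mathbf{X}^0$ are regarded as measures on $\mathbf{X}$. $\int_{\mathbf{X}}\mu$ denotes the total mass $\mu(\mathbf{X})$.
   Formalization: Uniqueness of the optimal solution is stated only for the components μ and μ̂; uniqueness of the whole tuple is false (f = id, X⁰ = X = [-1,1]: ν and a are arbitrary subject to the mass constraint). *)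

theory Defs
  imports "HOL-Analysis.Analysis"
begin

definition semialg_set :: "(nat \<Rightarrow> real ^ 'n \<Rightarrow> real) \<Rightarrow> nat \<Rightarrow> (real ^ 'n) set" where
  "semialg_set g m = {x. \<forall>j\<in>{1..m}. g j x \<ge> 0}"

abbreviation vol :: "(real ^ 'n) set \<Rightarrow> ennreal" where
  "vol A \<equiv> emeasure lborel A"

definition reach_upto :: "(real ^ 'n) set \<Rightarrow> (real ^ 'n \<Rightarrow> real ^ 'n) \<Rightarrow> nat \<Rightarrow> (real ^ 'n) set" where
  "reach_upto X0 f T = (\<Union>t\<le>T. (f ^^ t) ` X0)"

definition reach_set :: "(real ^ 'n) set \<Rightarrow> (real ^ 'n \<Rightarrow> real ^ 'n) \<Rightarrow> (real ^ 'n) set" where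
  "reach_set X0 f = (\<Union>T. reach_upto X0 f T)"

primrec first_reached :: "(real ^ 'n) set \<Rightarrow> (real ^ 'n \<Rightarrow> real ^ 'n) \<Rightarrow> nat \<Rightarrow> (real ^ 'n) set" where
  "first_reached X0 f 0 = X0"
| "first_reached X0 f (Suc t) = (f ^^ Suc t) ` X0 - reach_upto X0 f t"

text \<open>
  The cone of finite nonnegative Borel measures on \<open>A\<close>: such a measure has underlying space \<open>A\<close>
  and lives on the Borel subsets of \<open>A\<close>.
\<close>
definition borel_measures_on :: "(real ^ 'n) set \<Rightarrow> (real ^ 'n) measure set" where
  "borel_measures_on A = {M. sets M = sets (restrict_space borel A) \<and> finite_measure M}"

text \<open>\<open>1\<^sub>A(x) dx\<close> as a measure on \<open>X\<close>, for Borel \<open>A \<subseteq> X\<close>.\<close>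
definition lebesgue_part :: "(real ^ 'n) set \<Rightarrow> (real ^ 'n) set \<Rightarrow> (real ^ 'n) measure" where
  "lebesgue_part X A = density (restrict_space lborel X) (indicator A)"

text \<open>
  The pushforward is evaluated on Borel subsets of \<open>X\<close> only. As \<open>f\<close> need not map \<open>X\<close> into
  itself, mass that \<open>f\<close> sends outside \<open>X\<close> is lost; this is why the library's \<open>distr\<close>, which
  asks for \<open>f\<close> to be a measurable map between the two spaces, is not used.
\<close>
definition pushforward ::
  "(real ^ 'n) set \<Rightarrow> (real ^ 'n \<Rightarrow> real ^ 'n) \<Rightarrow> (real ^ 'n) measure \<Rightarrow> (real ^ 'n) set \<Rightarrow> ennreal" where
  "pushforward X f \<nu> A = emeasure \<nu> {x \<in> X. f x \<in> A}"

text \<open>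
  The library has no sum of two measures, so equations between measures on \<open>X\<close> are stated on every
  Borel subset of \<open>X\<close>. A measure \<open>\<mu>0\<close> on \<open>X0\<close> is read as the measure \<open>A \<mapsto> \<mu>0 (A \<inter> X0)\<close> on \<open>X\<close>.
\<close>
definition lp_feasible ::
  "(real ^ 'n) set \<Rightarrow> (real ^ 'n) set \<Rightarrow> (real ^ 'n \<Rightarrow> real ^ 'n) \<Rightarrow> nat \<Rightarrow>
    (real ^ 'n) measure \<Rightarrow> (real ^ 'n) measure \<Rightarrow> (real ^ 'n) measure \<Rightarrow> (real ^ 'n) measure \<Rightarrow> real \<Rightarrow> bool" where
  "lp_feasible X0 X f T \<mu>0 \<mu> \<mu>h \<nu> a \<longleftrightarrow>
     \<mu>0 \<in> borel_measures_on X0 \<and>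
     \<mu> \<in> borel_measures_on X \<and> \<mu>h \<in> borel_measures_on X \<and> \<nu> \<in> borel_measures_on X \<and>
     a \<ge> 0 \<and>
     emeasure \<nu> X + ennreal a = of_nat T * vol X \<and>
     (\<forall>A\<in>sets (restrict_space borel X).
        emeasure \<mu> A + emeasure \<nu> A = pushforward X f \<nu> A + emeasure \<mu>0 (A \<inter> X0)) \<and>
     (\<forall>A\<in>sets (restrict_space borel X).
        emeasure \<mu> A + emeasure \<mu>h A = emeasure (lebesgue_part X X) A)"

definition lp_value ::
  "(real ^ 'n) set \<Rightarrow> (real ^ 'n) set \<Rightarrow> (real ^ 'n \<Rightarrow> real ^ 'n) \<Rightarrow> nat \<Rightarrow> ennreal" where
  "lp_value X0 X f T = Sup {emeasure \<mu> X | \<mu>0 \<mu> \<mu>h \<nu> a. lp_feasible X0 X f T \<mu>0 \<mu> \<mu>h \<nu> a}"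

definition lp_optimal ::
  "(real ^ 'n) set \<Rightarrow> (real ^ 'n) set \<Rightarrow> (real ^ 'n \<Rightarrow> real ^ 'n) \<Rightarrow> nat \<Rightarrow>
    (real ^ 'n) measure \<Rightarrow> (real ^ 'n) measure \<Rightarrow> (real ^ 'n) measure \<Rightarrow> (real ^ 'n) measure \<Rightarrow> real \<Rightarrow> bool" where
  "lp_optimal X0 X f T \<mu>0 \<mu> \<mu>h \<nu> a \<longleftrightarrow>
     lp_feasible X0 X f T \<mu>0 \<mu> \<mu>h \<nu> a \<and> emeasure \<mu> X = lp_value X0 X f T"

text \<open>
  Uniqueness of the optimal solution concerns the components \<open>\<mu>\<close> and \<open>\<mu>h\<close>. The remaining components
  are never meant to be unique: if \<open>f = id\<close> and \<open>X0 = X\<close> is the unit ball, then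
  \<open>\<mu> = \<mu>0 = lebesgue_part X X\<close>, \<open>\<mu>h = 0\<close> is optimal together with every \<open>\<nu>\<close> of mass at most
  \<open>T * vol X\<close> and the corresponding \<open>a\<close>.
\<close>
definition lp_optimal_mu ::
  "(real ^ 'n) set \<Rightarrow> (real ^ 'n) set \<Rightarrow> (real ^ 'n \<Rightarrow> real ^ 'n) \<Rightarrow> nat \<Rightarrow>
    ((real ^ 'n) measure \<times> (real ^ 'n) measure) set" where
  "lp_optimal_mu X0 X f T = {(\<mu>, \<mu>h). \<exists>\<mu>0 \<nu> a. lp_optimal X0 X f T \<mu>0 \<mu> \<mu>h \<nu> a}"

end

theory Submission
  imports Defs
begin

text \<open>
  Write \<open>R k\<close> for the points reached in at most \<open>k\<close> steps. The linear program is a fractional knapsack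
  problem in disguise: a measure \<open>\<mu>\<close> below Lebesgue measure on \<open>X\<close> can be completed to a feasible
  plan only if it is carried by the reachable set and the integral of the first arrival time with
  respect to \<open>\<mu>\<close>, which is \<open>\<Sum>k. \<mu> (X - R k)\<close>, is at most the budget \<open>T * vol X\<close>. To see this,
  evaluate the flow equation on the sets \<open>X - R k\<close> and telescope (\<open>feasible_cost_bound\<close>).

  Conversely, Lebesgue measure on a reachable Borel set \<open>S\<close> whose arrival time integral respects
  the budget is feasible (\<open>feasible_of_cost\<close>): transport the mass ending at \<open>y\<close> along an orbit that
  arrives at \<open>y\<close> as early as possible, and let \<open>\<nu>\<close> be the occupation measure of these orbits. A
  measurable choice of the orbits exists since a continuous map on a compact set has a Borel section
  (\<open>continuous_borel_section\<close>), obtained by lexicographic minimisation in the fibres.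

  A knapsack is filled optimally in order of increasing arrival time. If the budget pays for the
  whole reachable set, then Lebesgue measure on it, or equally on its closure, is the only optimal
  \<open>\<mu>\<close> (\<open>optimal_mu_unique\<close>). Otherwise take a set \<open>S\<close> between some \<open>R K\<close> and \<open>R (K + 1)\<close> that exhausts
  the budget (\<open>exists_greedy_set\<close>, \<open>greedy_set_optimal\<close>); it exists since Lebesgue measure has no atoms,
  and it contains \<open>R T\<close>, since \<open>R T\<close> costs at most \<open>T * vol (R T)\<close>. Finally, the cost of the whole
  reachable set is at most \<open>\<Sum>t. t * vol (Y t)\<close>, where \<open>Y t\<close> is the set first reached at time \<open>t\<close>; if
  this is finite, every sufficiently large \<open>T\<close> provides enough budget.
\<close>

section \<open>Borel selections from compact-valued maps\<close>

text \<open>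
  One step of a lexicographic minimisation. Shrinking every \<open>F y\<close> to its points of least
  \<open>b\<close>-coordinate preserves measurability: the minimum over \<open>F y \<inter> C\<close> exceeds the minimum over
  \<open>F y\<close> exactly if some rational half-space \<open>{x. x \<bullet> b \<le> q}\<close> meets \<open>F y\<close> but not \<open>F y \<inter> C\<close>, and
  there are countably many of these.
\<close>
lemma refine_selection:
  fixes F :: "'b \<Rightarrow> 'a::euclidean_space set" and b :: 'a
  assumes comp: "\<And>y. y \<in> space M \<Longrightarrow> compact (F y)"
    and meas: "\<And>C. closed C \<Longrightarrow> {y \<in> space M. F y \<inter> C \<noteq> {}} \<in> sets M"
  defines "G \<equiv> \<lambda>y. {x \<in> F y. \<forall>z\<in>F y. x \<bullet> b \<le> z \<bullet> b}"
  shows "\<And>y. y \<in> space M \<Longrightarrow> compact (G y)"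
    and "\<And>y. y \<in> space M \<Longrightarrow> F y \<noteq> {} \<Longrightarrow> G y \<noteq> {}"
    and "\<And>C. closed C \<Longrightarrow> {y \<in> space M. G y \<inter> C \<noteq> {}} \<in> sets M"
proof -
  \<comment> \<open>The case \<open>C = UNIV\<close> yields non-emptiness, the general case the formula for measurability.\<close>
  have min_ex: "\<exists>x\<in>F y \<inter> C. \<forall>z\<in>F y \<inter> C. x \<bullet> b \<le> z \<bullet> b"
    if "y \<in> space M" "closed C" "F y \<inter> C \<noteq> {}" for y C
    using that comp by (intro continuous_attains_inf compact_Int_closed continuous_intros)
  show "compact (G y)" if "y \<in> space M" for y
  proof -
    have "G y = F y \<inter> (\<Inter>z\<in>F y. {x. x \<bullet> b \<le> z \<bullet> b})"
      by (auto simp: G_def)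
    moreover have "closed (\<Inter>z\<in>F y. {x. x \<bullet> b \<le> z \<bullet> b})"
      by (intro closed_INT ballI closed_Collect_le continuous_intros)
    ultimately show ?thesis
      using comp[OF that] by (metis compact_Int_closed)
  qed
  show "G y \<noteq> {}" if "y \<in> space M" "F y \<noteq> {}" for y
    using min_ex[of y UNIV] that by (auto simp: G_def)
  show "{y \<in> space M. G y \<inter> C \<noteq> {}} \<in> sets M" if C: "closed C" for C
  proof -
    define H where "H q = {x::'a. x \<bullet> b \<le> of_rat q}" for q
    have cl: "closed (H q)" for q
      unfolding H_def by (intro closed_Collect_le continuous_intros)
    have "{y \<in> space M. G y \<inter> C \<noteq> {}} = {y \<in> space M. F y \<inter> C \<noteq> {}} -
        (\<Union>q. {y \<in> space M. F y \<inter> H q \<noteq> {}} - {y \<in> space M. F y \<inter> (C \<inter> H q) \<noteq> {}})"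
      (is "?L = ?R")
    proof (intro set_eqI iffI)
      fix y assume "y \<in> ?L"
      then obtain x where x: "y \<in> space M" "x \<in> F y" "x \<in> C" "\<forall>z\<in>F y. x \<bullet> b \<le> z \<bullet> b"
        by (auto simp: G_def)
      have "F y \<inter> (C \<inter> H q) \<noteq> {}" if "F y \<inter> H q \<noteq> {}" for q
      proof -
        obtain z where "z \<in> F y" "z \<bullet> b \<le> of_rat q" using \<open>F y \<inter> H q \<noteq> {}\<close> by (auto simp: H_def)
        with x have "x \<in> F y \<inter> (C \<inter> H q)" by (force simp: H_def)
        then show ?thesis by blast
      qed
      with x show "y \<in> ?R" by blast
    next
      fix y assume y: "y \<in> ?R"
      then obtain x where x: "x \<in> F y \<inter> C" "\<forall>z\<in>F y \<inter> C. x \<bullet> b \<le> z \<bullet> b"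
        using min_ex[of y C] C by auto
      have "x \<bullet> b \<le> z \<bullet> b" if z: "z \<in> F y" for z
      proof (rule ccontr)
        assume "\<not> ?thesis"
        then obtain q where q: "z \<bullet> b < of_rat q" "of_rat q < x \<bullet> b"
          using of_rat_dense[of "z \<bullet> b" "x \<bullet> b"] by auto
        with z have "F y \<inter> H q \<noteq> {}" by (auto simp: H_def intro!: less_imp_le)
        with y have "F y \<inter> (C \<inter> H q) \<noteq> {}" by auto
        with x q show False by (force simp: H_def)
      qed
      with x y show "y \<in> ?L" by (auto simp: G_def)
    qed
    also have "\<dots> \<in> sets M"
      using C cl by (intro sets.Diff sets.countable_UN) (auto intro!: meas closed_Int)
    finally show ?thesis .
  qed
qed

text \<open>
  Minimising one coordinate after the other leaves a single point in every \<open>F y\<close>. The measurability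
  condition on the final singleton-valued map says that the preimages of closed sets are measurable.
\<close>
lemma measurable_selection_compact:
  fixes F :: "'b \<Rightarrow> 'a::euclidean_space set"
  assumes comp: "\<And>y. y \<in> space M \<Longrightarrow> compact (F y)"
    and ne: "\<And>y. y \<in> space M \<Longrightarrow> F y \<noteq> {}"
    and meas: "\<And>C. closed C \<Longrightarrow> {y \<in> space M. F y \<inter> C \<noteq> {}} \<in> sets M"
  shows "\<exists>s \<in> borel_measurable M. \<forall>y\<in>space M. s y \<in> F y"
proof -
  \<comment> \<open>The coordinates in \<open>B\<close> are already constant on every value of \<open>G\<close>.\<close>
  define P where "P B G \<longleftrightarrow> (\<forall>y\<in>space M. compact (G y) \<and> G y \<noteq> {} \<and> G y \<subseteq> F y) \<and>
      (\<forall>C. closed C \<longrightarrow> {y \<in> space M. G y \<inter> C \<noteq> {}} \<in> sets M) \<and>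
      (\<forall>y\<in>space M. \<forall>b\<in>B. \<exists>r. G y \<subseteq> {u. u \<bullet> b = r})" for B G
  have "\<exists>G. P B G" if "finite B" for B
    using that
  proof (induction B)
    case empty
    show ?case using comp ne meas by (intro exI[of _ F]) (auto simp: P_def)
  next
    case (insert b B)
    then obtain G where "P B G" by auto
    note PG = this[unfolded P_def]
    have G: "\<And>y. y \<in> space M \<Longrightarrow> compact (G y)" "\<And>y. y \<in> space M \<Longrightarrow> G y \<noteq> {}"
        "\<And>y. y \<in> space M \<Longrightarrow> G y \<subseteq> F y"
      using PG[THEN conjunct1] by blast+
    note Gm = PG[THEN conjunct2, THEN conjunct1, rule_format]
      and Ge = PG[THEN conjunct2, THEN conjunct2, rule_format]
    define G' where "G' = (\<lambda>y. {x \<in> G y. \<forall>z\<in>G y. x \<bullet> b \<le> z \<bullet> b})"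
    have a: "compact (G' y) \<and> G' y \<noteq> {} \<and> G' y \<subseteq> F y" if "y \<in> space M" for y
      using refine_selection(1,2)[where M=M and F=G and b=b, OF G(1) Gm that] G(2,3)[OF that]
      unfolding G'_def by auto
    have b: "{y \<in> space M. G' y \<inter> C \<noteq> {}} \<in> sets M" if "closed C" for C
      using refine_selection(3)[where M=M and F=G and b=b, OF G(1) Gm that] unfolding G'_def .
    have c: "\<exists>r. G' y \<subseteq> {u. u \<bullet> c = r}" if y: "y \<in> space M" "c \<in> insert b B" for y c
    proof (cases "c = b")
      case True
      obtain x where "x \<in> G' y"
        using a[OF y(1)] by auto
      then have "G' y \<subseteq> {u. u \<bullet> c = x \<bullet> b}"
        using True by (auto simp: G'_def intro!: antisym)
      then show ?thesis by blast
    next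
      case False
      then obtain r where "G y \<subseteq> {u. u \<bullet> c = r}" using y Ge[of y c] by auto
      moreover have "G' y \<subseteq> G y" by (auto simp: G'_def)
      ultimately show ?thesis by blast
    qed
    have "P (insert b B) G'"
      unfolding P_def by (intro conjI[OF _ conjI] ballI allI impI a b c)
    then show ?case by blast
  qed
  from this[OF finite_Basis] obtain G where "P Basis G" by auto
  note PG = this[unfolded P_def]
  have G: "\<And>y. y \<in> space M \<Longrightarrow> G y \<noteq> {}" "\<And>y. y \<in> space M \<Longrightarrow> G y \<subseteq> F y"
    using PG[THEN conjunct1] by blast+
  note Gm = PG[THEN conjunct2, THEN conjunct1, rule_format]
    and Ge = PG[THEN conjunct2, THEN conjunct2, rule_format]
  define s where "s y = (SOME x. x \<in> G y)" for y
  have s: "s y \<in> G y" if "y \<in> space M" for y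
    using G(1)[OF that] unfolding s_def by (simp add: some_in_eq)
  have sing: "G y = {s y}" if "y \<in> space M" for y
  proof -
    have "x \<in> {s y}" if x: "x \<in> G y" for x
    proof -
      have "x \<bullet> c = s y \<bullet> c" if "c \<in> Basis" for c
      proof -
        obtain r where "G y \<subseteq> {u. u \<bullet> c = r}"
          using Ge \<open>y \<in> space M\<close> \<open>c \<in> Basis\<close> by blast
        then show ?thesis using x s[OF \<open>y \<in> space M\<close>] by auto
      qed
      then have "x = s y" by (rule euclidean_eqI)
      then show ?thesis by simp
    qed
    with s[OF that] show ?thesis by blast
  qed
  have "s \<in> borel_measurable M"
    unfolding borel_eq_closed
  proof (rule measurable_measure_of)
    fix C :: "'a set" assume "C \<in> Collect closed"
    moreover have "s -` C \<inter> space M = {y \<in> space M. G y \<inter> C \<noteq> {}}"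
      using sing by auto
    ultimately show "s -` C \<inter> space M \<in> sets M" using Gm by simp
  qed auto
  then show ?thesis using s G(2) by auto
qed

text \<open>
  The fibres of \<open>h\<close> over \<open>h ` K\<close> are compact, and the values whose fibre meets a closed set \<open>C\<close>
  form the compact set \<open>h ` (K \<inter> C)\<close>; so the selection theorem applies. Off the image, the
  multifunction is given the dummy value \<open>{0}\<close> to make it non-empty everywhere.
\<close>
lemma continuous_borel_section:
  fixes h :: "'a::euclidean_space \<Rightarrow> 'b::t2_space"
  assumes K: "compact K" and h: "continuous_on K h"
  shows "\<exists>s\<in>borel_measurable borel. \<forall>y\<in>h ` K. s y \<in> K \<and> h (s y) = y"
proof -
  define F where "F y = (if y \<in> h ` K then {x\<in>K. h x = y} else {0})" for y
  have cl: "closed (h ` (K \<inter> C))" if "closed C" for C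
    using that K h by (meson compact_Int_closed compact_continuous_image compact_imp_closed
      continuous_on_subset inf_le1)
  have clK: "closed (h ` K)" using cl[of UNIV] by simp
  have "\<exists>s\<in>borel_measurable borel. \<forall>y\<in>space borel. s y \<in> F y"
  proof (rule measurable_selection_compact)
    fix y
    have "compact {x\<in>K. h x = y}"
    proof -
      have "closedin (top_of_set K) (K \<inter> h -` {y})"
        using h by (intro continuous_closedin_preimage) auto
      moreover have "K \<inter> h -` {y} = {x\<in>K. h x = y}" by auto
      ultimately show ?thesis using K closedin_compact by metis
    qed
    then show "compact (F y)" by (auto simp: F_def)
    show "F y \<noteq> {}" by (auto simp: F_def)
  next
    fix C :: "'a set" assume C: "closed C"
    have "{y \<in> space borel. F y \<inter> C \<noteq> {}} = h ` (K \<inter> C) \<union> (if 0 \<in> C then - (h ` K) else {})"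
    proof (intro set_eqI)
      fix y
      show "y \<in> {y \<in> space borel. F y \<inter> C \<noteq> {}} \<longleftrightarrow>
          y \<in> h ` (K \<inter> C) \<union> (if 0 \<in> C then - (h ` K) else {})"
      proof (cases "y \<in> h ` K")
        case True
        then have "F y = {x\<in>K. h x = y}" by (simp add: F_def)
        then have "F y \<inter> C \<noteq> {} \<longleftrightarrow> (\<exists>x\<in>K \<inter> C. y = h x)"
          unfolding ex_in_conv[symmetric] by auto
        also have "\<dots> \<longleftrightarrow> y \<in> h ` (K \<inter> C)" by (simp only: image_iff)
        finally show ?thesis using True by simp
      next
        case False
        then have "F y = {0}" by (simp add: F_def)
        with False show ?thesis by auto
      qed
    qed
    also have "\<dots> \<in> sets borel"
      using cl[OF C] clK by (auto intro!: sets.Un)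
    finally show "{y \<in> space borel. F y \<inter> C \<noteq> {}} \<in> sets borel" .
  qed
  then obtain s where s: "s \<in> borel_measurable borel" "\<And>y. s y \<in> F y" by auto
  have "s y \<in> K \<and> h (s y) = y" if "y \<in> h ` K" for y
    using s(2)[of y] that by (simp add: F_def)
  with s(1) show ?thesis by auto
qed

section \<open>Sums of measures, images and parts of Lebesgue measure\<close>

lemma suminf_swap_ennreal:
  fixes u :: "nat \<Rightarrow> nat \<Rightarrow> ennreal"
  shows "(\<Sum>i. \<Sum>j. u i j) = (\<Sum>j. \<Sum>i. u i j)"
  using nn_integral_suminf[of "\<lambda>j i. u i j" "count_space UNIV"]
  by (simp add: nn_integral_count_space_nat)

lemma measure_sum_exists:
  fixes N :: "nat \<Rightarrow> 'a measure"
  assumes N: "\<And>k. sets (N k) = sets M"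
  shows "\<exists>\<nu>. sets \<nu> = sets M \<and> (\<forall>A\<in>sets M. emeasure \<nu> A = (\<Sum>k. emeasure (N k) A))"
proof -
  define \<nu> where "\<nu> = measure_of (space M) (sets M) (\<lambda>A. \<Sum>k. emeasure (N k) A)"
  have "sets \<nu> = sets M"
    by (simp add: \<nu>_def)
  moreover have "emeasure \<nu> A = (\<Sum>k. emeasure (N k) A)" if "A \<in> sets M" for A
  proof (rule emeasure_measure_of[OF \<nu>_def])
    show "countably_additive (sets \<nu>) (\<lambda>A. \<Sum>k. emeasure (N k) A)"
    proof (rule countably_additiveI)
      fix A :: "nat \<Rightarrow> 'a set"
      assume "range A \<subseteq> sets \<nu>" "disjoint_family A"
      then have "(\<Sum>i. emeasure (N k) (A i)) = emeasure (N k) (\<Union>i. A i)" for k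
        using N by (intro suminf_emeasure) (auto simp: \<nu>_def)
      then show "(\<Sum>i. \<Sum>k. emeasure (N k) (A i)) = (\<Sum>k. emeasure (N k) (\<Union>i. A i))"
        by (subst suminf_swap_ennreal) simp
    qed
  qed (use that sets.space_closed in \<open>auto simp: \<nu>_def positive_def\<close>)
  ultimately show ?thesis by blast
qed

text \<open>
  The measures \<open>\<mu>0\<close> and \<open>\<nu>\<close> of a transport plan are assembled from images of Lebesgue measure on some
  Borel set of targets under a map that sends each target to a point of its orbit.
\<close>
lemma transported_lebesgue:
  fixes h :: "real ^ 'n \<Rightarrow> real ^ 'n"
  assumes h[measurable]: "h \<in> borel_measurable borel" and D[measurable]: "D \<in> sets borel"
    and Z[measurable]: "Z \<in> sets borel" and hZ: "h ` D \<subseteq> Z"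
  defines "N \<equiv> distr (restrict_space lborel D) (restrict_space borel Z) h"
  shows "sets N = sets (restrict_space borel Z)"
    and "A \<in> sets (restrict_space borel Z) \<Longrightarrow> emeasure N A = vol {y\<in>D. h y \<in> A}"
proof -
  show "sets N = sets (restrict_space borel Z)" by (simp add: N_def)
  assume A: "A \<in> sets (restrict_space borel Z)"
  have hm: "h \<in> restrict_space lborel D \<rightarrow>\<^sub>M restrict_space borel Z"
    using hZ by (intro measurable_restrict_space2 measurable_restrict_space1)
      (auto simp: space_restrict_space)
  have A': "A \<in> sets borel" using A by (auto simp: sets_restrict_space)
  have "emeasure N A = emeasure (restrict_space lborel D) (h -` A \<inter> D)"
    unfolding N_def by (subst emeasure_distr[OF hm A]) (simp add: space_restrict_space)
  also have "\<dots> = vol (h -` A \<inter> D)"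
    by (intro emeasure_restrict_space) auto
  also have "h -` A \<inter> D = {y\<in>D. h y \<in> A}" by auto
  finally show "emeasure N A = vol {y\<in>D. h y \<in> A}" .
qed

lemma sets_lebesgue_part [simp]:
  "sets (lebesgue_part X A) = sets (restrict_space borel X)"
  unfolding lebesgue_part_def by (simp, rule sets_restrict_space_cong, simp)

lemma emeasure_lebesgue_part:
  assumes X: "X \<in> sets borel" and S: "S \<in> sets borel" and A: "A \<in> sets (restrict_space borel X)"
  shows "emeasure (lebesgue_part X S) A = vol (S \<inter> A)"
proof -
  have AX: "A \<subseteq> X" "A \<in> sets borel" using A X by (auto simp: sets_restrict_space)
  have A': "A \<in> sets (restrict_space lborel X)"
    using AX X by (simp add: sets_restrict_space_iff)
  have "indicator S \<in> borel_measurable (restrict_space lborel X)"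
    using S by (intro measurable_restrict_space1) simp
  then have "emeasure (lebesgue_part X S) A =
      (\<integral>\<^sup>+x. indicator S x * indicator A x \<partial>restrict_space lborel X)"
    unfolding lebesgue_part_def using A' by (subst emeasure_density) auto
  also have "\<dots> = (\<integral>\<^sup>+x. indicator S x * indicator A x * indicator X x \<partial>lborel)"
    using X by (intro nn_integral_restrict_space) simp
  also have "\<dots> = (\<integral>\<^sup>+x. indicator (S \<inter> A) x \<partial>lborel)"
    using AX by (intro nn_integral_cong) (auto split: split_indicator)
  also have "\<dots> = vol (S \<inter> A)" using S AX by simp
  finally show ?thesis .
qed

text \<open>
  Lebesgue measure has no atoms: the volume of \<open>Y \<inter> cball 0 r\<close> grows no faster than the volume of the
  ball \<open>cball 0 r\<close>, hence depends continuously on \<open>r\<close>, and takes every value between \<open>0\<close> and the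
  volume of \<open>Y\<close>.
\<close>
lemma exists_borel_subset_of_volume:
  fixes Y :: "'a::euclidean_space set"
  assumes Y: "Y \<in> sets borel" "bounded Y" and v: "v \<le> emeasure lborel Y"
  shows "\<exists>Z\<in>sets borel. Z \<subseteq> Y \<and> emeasure lborel Z = v"
proof -
  have fin: "emeasure lborel (Y \<inter> C) < \<infinity>" for C
    using Y(2) by (meson bounded_Int emeasure_bounded_finite)
  have fm: "Y \<inter> cball 0 r \<in> fmeasurable lborel" for r
    using fin Y by (auto simp: fmeasurable_def)
  define m where "m r = measure lborel (Y \<inter> cball 0 r)" for r
  define V where "V r = measure lborel (cball (0::'a) r)" for r
  have lip: "\<bar>m r' - m r\<bar> \<le> \<bar>V r' - V r\<bar>" if "r \<le> r'" for r r'
  proof -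
    have sub: "cball (0::'a) r \<subseteq> cball 0 r'" using that by auto
    have c: "cball (0::'a) r \<in> fmeasurable lborel" for r
      using emeasure_bounded_finite[OF bounded_cball[of "0::'a" r]] by (simp add: fmeasurable_def)
    have "m r' - m r = measure lborel (Y \<inter> cball 0 r' - Y \<inter> cball 0 r)"
      unfolding m_def using Y fm sub by (subst measurable_measure_Diff) auto
    also have "\<dots> \<le> measure lborel (cball (0::'a) r' - cball 0 r)"
      using Y c by (intro measure_mono_fmeasurable) (auto intro!: fmeasurable_Diff)
    also have "\<dots> = V r' - V r"
      unfolding V_def using c sub by (subst measurable_measure_Diff) auto
    finally have "m r' - m r \<le> V r' - V r" .
    moreover have "m r \<le> m r'"
      unfolding m_def using Y sub fm by (intro measure_mono_fmeasurable) auto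
    ultimately show ?thesis by simp
  qed
  have contV: "continuous_on {0..} V"
  proof (rule continuous_on_eq)
    show "continuous_on {0..} (\<lambda>r. unit_ball_vol (real DIM('a)) * r ^ DIM('a))"
      by (intro continuous_intros)
    show "\<And>r. r \<in> {0..} \<Longrightarrow> unit_ball_vol (real DIM('a)) * r ^ DIM('a) = V r"
      unfolding V_def by (simp add: content_cball)
  qed
  have contm: "continuous_on {0..} m"
    unfolding continuous_on_iff
  proof (intro ballI allI impI)
    fix x e :: real assume "x \<in> {0..}" "0 < e"
    with contV obtain d where d: "d > 0" "\<And>x'. x' \<in> {0..} \<Longrightarrow> dist x' x < d \<Longrightarrow> dist (V x') (V x) < e"
      unfolding continuous_on_iff by blast
    have "dist (m x') (m x) \<le> dist (V x') (V x)" for x'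
      using lip[of x x'] lip[of x' x] by (cases "x \<le> x'") (auto simp: dist_real_def abs_minus_commute)
    with d show "\<exists>d>0. \<forall>x'\<in>{0..}. dist x' x < d \<longrightarrow> dist (m x') (m x) < e"
      by (meson le_less_trans)
  qed
  obtain R where R: "R > 0" "Y \<subseteq> cball 0 R"
    using bounded_subset_ballD[OF Y(2), of 0] ball_subset_cball by blast
  have mR: "m R = measure lborel Y" unfolding m_def using R by (simp add: Int_absorb2)
  have vR: "emeasure lborel Y = ennreal (m R)"
    using fin[of UNIV] by (simp add: mR emeasure_eq_ennreal_measure less_top)
  have v': "v = ennreal (enn2real v)" "enn2real v \<le> m R"
  proof -
    have "v < top" using v vR by (simp add: le_less_trans)
    then show "v = ennreal (enn2real v)" by simp
    show "enn2real v \<le> m R" using v vR by (intro enn2real_leI) (auto simp: m_def)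
  qed
  have m0: "m 0 = 0"
  proof -
    have "m 0 \<le> V 0" unfolding m_def V_def
      using Y by (intro measure_mono_fmeasurable) (auto simp: fmeasurable_def)
    also have "V 0 = 0" by (simp add: V_def)
    finally show ?thesis by (simp add: m_def antisym)
  qed
  have "\<exists>r\<ge>0. r \<le> R \<and> m r = enn2real v"
    using R v' m0 by (intro IVT' continuous_on_subset[OF contm]) auto
  then obtain r where r: "m r = enn2real v" by auto
  have "emeasure lborel (Y \<inter> cball 0 r) = ennreal (m r)"
    using fin[of "cball 0 r"] unfolding m_def by (intro emeasure_eq_ennreal_measure) auto
  then have "emeasure lborel (Y \<inter> cball 0 r) = v" using r v'(1) by simp
  then show ?thesis using Y by (intro bexI[of _ "Y \<inter> cball 0 r"]) auto
qed

lemma lebesgue_part_eqI: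
  assumes X: "X \<in> sets borel" and A: "A \<in> sets borel" and B: "B \<in> sets borel"
    and "A \<subseteq> B" "vol A = vol B" "vol A < \<infinity>"
  shows "lebesgue_part X A = lebesgue_part X B"
proof (rule measure_eqI)
  fix C assume "C \<in> sets (lebesgue_part X A)"
  then have C: "C \<in> sets (restrict_space borel X)" by simp
  then have [measurable]: "C \<in> sets borel" using X by (auto simp: sets_restrict_space)
  have null: "vol (B - A) = 0"
    using assms by (subst emeasure_Diff) auto
  have "vol (B \<inter> C) \<le> vol ((A \<inter> C) \<union> (B - A))"
    using A B by (intro emeasure_mono) auto
  also have "\<dots> \<le> vol (A \<inter> C) + vol (B - A)"
    using A B by (intro emeasure_subadditive) auto
  finally have "vol (B \<inter> C) \<le> vol (A \<inter> C)" by (simp add: null)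
  moreover have "vol (A \<inter> C) \<le> vol (B \<inter> C)"
    using A B \<open>A \<subseteq> B\<close> by (intro emeasure_mono) auto
  ultimately show "emeasure (lebesgue_part X A) C = emeasure (lebesgue_part X B) C"
    using C X A B by (simp add: emeasure_lebesgue_part antisym)
qed simp

section \<open>Reachable sets and backward orbits\<close>

locale reachability =
  fixes X0 X :: "(real ^ 'n) set" and f :: "real ^ 'n \<Rightarrow> real ^ 'n"
  assumes X0_compact: "compact X0" and X_compact: "compact X"
    and f_cont: "continuous_on UNIV f"
    and reach_sub: "reach_set X0 f \<subseteq> X"
begin

abbreviation R where "R \<equiv> reach_upto X0 f"
abbreviation Xinf where "Xinf \<equiv> reach_set X0 f"

lemma continuous_iterate: "continuous_on UNIV (f ^^ t)"
proof (induction t)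
  case (Suc t)
  then show ?case
    using f_cont by (auto intro: continuous_on_compose2[of UNIV f])
qed (simp add: id_def)

lemma compact_iterate_image: "compact ((f ^^ t) ` X0)"
  using X0_compact continuous_iterate
  by (intro compact_continuous_image) (auto intro: continuous_on_subset)

lemma compact_reach_upto: "compact (R k)"
  unfolding reach_upto_def by (intro compact_UN compact_iterate_image) auto

lemma borel_reach [measurable]:
  "X0 \<in> sets borel" "X \<in> sets borel" "R k \<in> sets borel" "Xinf \<in> sets borel"
  "f \<in> borel_measurable borel" "f ^^ k \<in> borel_measurable borel"
proof -
  show R: "R k \<in> sets borel" for k using compact_reach_upto by (rule borel_compact)
  then show "Xinf \<in> sets borel" unfolding reach_set_def by auto
qed (use X0_compact X_compact f_cont continuous_iterate in
      \<open>auto intro: borel_compact borel_measurable_continuous_onI\<close>)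

lemma reach_upto_mono: "k \<le> l \<Longrightarrow> R k \<subseteq> R l"
  by (force simp: reach_upto_def)

lemma reach_upto_0: "R 0 = X0"
  by (simp add: reach_upto_def)

lemma reach_upto_subset: "R k \<subseteq> Xinf"
  by (auto simp: reach_set_def)

lemma reach_upto_step: "x \<in> R k \<Longrightarrow> f x \<in> R (Suc k)"
  unfolding reach_upto_def
  by (smt (verit) Suc_le_mono UN_iff atMost_iff funpow.simps(2) image_iff o_apply)

lemma iterate_in_reach_set: "x \<in> X0 \<Longrightarrow> (f ^^ k) x \<in> Xinf"
  by (auto simp: reach_set_def reach_upto_def)

lemma vol_subset_X_finite: "A \<subseteq> X \<Longrightarrow> vol A < \<infinity>"
  using X_compact by (meson bounded_subset compact_imp_bounded emeasure_bounded_finite)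

text \<open>
  Every reachable point \<open>y\<close> has a first arrival time \<open>\<tau> y\<close>, and a starting point \<open>s y\<close> whose orbit
  arrives at \<open>y\<close> at that time. Both can be chosen measurably, by gluing Borel sections of the iterates
  of \<open>f\<close> along the sets on which \<open>\<tau>\<close> is constant.
\<close>
lemma measurable_backward_orbit:
  "\<exists>s \<tau>. s \<in> borel_measurable borel \<and> \<tau> \<in> measurable borel (count_space UNIV) \<and>
     (\<forall>y\<in>Xinf. s y \<in> X0 \<and> (f ^^ \<tau> y) (s y) = y \<and> (\<forall>k. k < \<tau> y \<longleftrightarrow> y \<notin> R k))"
proof -
  have "\<exists>s\<in>borel_measurable borel. \<forall>y\<in>(f ^^ t) ` X0. s y \<in> X0 \<and> (f ^^ t) (s y) = y" for t
    using X0_compact continuous_iterate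
    by (intro continuous_borel_section) (auto intro: continuous_on_subset)
  then obtain s where s[measurable]: "\<And>t. s t \<in> borel_measurable borel"
    and sec: "\<And>t y. y \<in> (f ^^ t) ` X0 \<Longrightarrow> s t y \<in> X0 \<and> (f ^^ t) (s t y) = y"
    by metis
  define \<tau> where "\<tau> y = (LEAST t. y \<in> (f ^^ t) ` X0)" for y
  have [measurable]: "(f ^^ t) ` X0 \<in> sets borel" for t
    using compact_iterate_image by (rule borel_compact)
  have \<tau>[measurable]: "\<tau> \<in> measurable borel (count_space UNIV)"
    unfolding \<tau>_def by measurable
  have "(\<lambda>y. s (\<tau> y) y) \<in> borel_measurable borel"
    by (rule measurable_compose_countable[OF s \<tau>])
  moreover have "s (\<tau> y) y \<in> X0 \<and> (f ^^ \<tau> y) (s (\<tau> y) y) = y \<and> (\<forall>k. k < \<tau> y \<longleftrightarrow> y \<notin> R k)"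
    if "y \<in> Xinf" for y
  proof -
    obtain t where t: "y \<in> (f ^^ t) ` X0"
      using \<open>y \<in> Xinf\<close> unfolding reach_set_def reach_upto_def by blast
    have *: "y \<in> (f ^^ \<tau> y) ` X0" unfolding \<tau>_def using t by (rule LeastI)
    moreover have "k < \<tau> y \<longleftrightarrow> y \<notin> R k" for k
    proof
      assume k: "k < \<tau> y"
      have "y \<notin> (f ^^ i) ` X0" if "i \<le> k" for i
        using k that unfolding \<tau>_def by (intro not_less_Least) simp
      then show "y \<notin> R k" unfolding reach_upto_def by blast
    next
      assume "y \<notin> R k"
      then show "k < \<tau> y"
        using * unfolding reach_upto_def by (meson UN_I atMost_iff not_le)
    qed
    ultimately show ?thesis using sec by blast
  qed
  ultimately show ?thesis using \<tau> by (intro exI[of _ "\<lambda>y. s (\<tau> y) y"] exI[of _ \<tau>]) blast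
qed

section \<open>Transport plans with a given cost\<close>

text \<open>
  This is the integral of the first arrival time over \<open>S\<close>, written as a sum over its superlevel sets
  \<open>S - R k\<close>; points that are never reached have infinite arrival time.
\<close>
definition travel_cost :: "(real ^ 'n) set \<Rightarrow> ennreal" where
  "travel_cost S = (\<Sum>k. vol (S - R k))"

lemma lebesgue_part_in_borel_measures_on:
  assumes "S \<in> sets borel"
  shows "lebesgue_part X S \<in> borel_measures_on X"
proof -
  have "X \<in> sets (restrict_space borel X)" by (auto simp: sets_restrict_space)
  then have "emeasure (lebesgue_part X S) X = vol (S \<inter> X)"
    using assms by (intro emeasure_lebesgue_part) auto
  also have "\<dots> < \<infinity>" by (rule vol_subset_X_finite) auto
  finally have "emeasure (lebesgue_part X S) X \<noteq> \<infinity>" by simp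
  moreover have "space (lebesgue_part X S) = X"
    using sets_eq_imp_space_eq[OF sets_lebesgue_part] by (simp add: space_restrict_space)
  ultimately show ?thesis
    unfolding borel_measures_on_def by (auto intro: finite_measureI)
qed

text \<open>
  Move the mass that is to end at \<open>y \<in> S\<close> along the orbit of its starting point \<open>s y\<close>. The
  occupation measure \<open>\<nu>\<close> counts all positions before the arrival at time \<open>\<tau> y\<close>, so its mass is the
  travel cost of \<open>S\<close>; the slack \<open>a\<close> absorbs the unused budget. The flow equation telescopes: positions
  at times \<open>0, \<dots>, \<tau> y\<close> can be split as the last one (which is \<open>y\<close>, giving \<open>\<mu>\<close>) and the earlier ones
  (\<open>\<nu>\<close>), or as the first one (\<open>\<mu>0\<close>) and the images of the earlier ones (the pushforward of \<open>\<nu>\<close>).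
\<close>
lemma feasible_of_cost:
  assumes S[measurable]: "S \<in> sets borel" and SX: "S \<subseteq> Xinf"
    and cost: "travel_cost S \<le> of_nat T * vol X"
  shows "\<exists>\<mu>0 \<nu> a. lp_feasible X0 X f T \<mu>0 (lebesgue_part X S) (lebesgue_part X (X - S)) \<nu> a"
proof -
  obtain s \<tau> where s[measurable]: "s \<in> borel_measurable borel"
    and \<tau>[measurable]: "\<tau> \<in> measurable borel (count_space UNIV)"
    and s\<tau>: "\<And>y. y \<in> Xinf \<Longrightarrow> s y \<in> X0" "\<And>y. y \<in> Xinf \<Longrightarrow> (f ^^ \<tau> y) (s y) = y"
      "\<And>y k. y \<in> Xinf \<Longrightarrow> k < \<tau> y \<longleftrightarrow> y \<notin> R k"
    using measurable_backward_orbit by blast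
  define g where "g k y = (f ^^ k) (s y)" for k y
  have [measurable]: "g k \<in> borel_measurable borel" for k
    unfolding g_def using measurable_compose[OF s borel_reach(6)] .
  have gX: "g k y \<in> X" if "y \<in> S" for k y
    using iterate_in_reach_set[OF s\<tau>(1)] that SX reach_sub unfolding g_def by blast
  \<comment> \<open>The mass travelling at time \<open>k\<close> is the one whose target lies outside \<open>R k\<close>, at position \<open>g k y\<close>.\<close>
  define N where "N k = distr (restrict_space lborel (S - R k)) (restrict_space borel X) (g k)" for k
  have N: "sets (N k) = sets (restrict_space borel X)"
    "A \<in> sets (restrict_space borel X) \<Longrightarrow> emeasure (N k) A = vol {y \<in> S - R k. g k y \<in> A}" for k A
    unfolding N_def using gX by (intro transported_lebesgue; auto)+
  obtain \<nu> where \<nu>: "sets \<nu> = sets (restrict_space borel X)"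
    "\<And>A. A \<in> sets (restrict_space borel X) \<Longrightarrow> emeasure \<nu> A = (\<Sum>k. vol {y \<in> S - R k. g k y \<in> A})"
    using measure_sum_exists[of N, OF N(1)] N(2) by auto
  define \<mu>0 where "\<mu>0 = distr (restrict_space lborel S) (restrict_space borel X0) s"
  have \<mu>0: "sets \<mu>0 = sets (restrict_space borel X0)"
    "A \<in> sets (restrict_space borel X0) \<Longrightarrow> emeasure \<mu>0 A = vol {y \<in> S. s y \<in> A}" for A
    unfolding \<mu>0_def using s\<tau>(1) SX by (intro transported_lebesgue; auto)+
  have sets_rX: "A \<in> sets (restrict_space borel X) \<longleftrightarrow> A \<subseteq> X \<and> A \<in> sets borel" for A
    by (simp add: sets_restrict_space_iff)
  have sets_rX0: "A \<in> sets (restrict_space borel X0) \<longleftrightarrow> A \<subseteq> X0 \<and> A \<in> sets borel" for A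
    by (simp add: sets_restrict_space_iff)
  have SsubX: "S \<subseteq> X" using SX reach_sub by auto
  have \<nu>X: "emeasure \<nu> X = travel_cost S"
  proof -
    have "{y \<in> S - R k. g k y \<in> X} = S - R k" for k using gX by auto
    then show ?thesis by (simp add: \<nu>(2) sets_rX travel_cost_def)
  qed
  have TX: "of_nat T * vol X < \<infinity>"
    using vol_subset_X_finite[of X] by (simp add: ennreal_mult_less_top of_nat_less_top)
  have \<nu>fin: "emeasure \<nu> X < \<infinity>" using \<nu>X cost TX by (metis le_less_trans)
  have spaces: "space \<nu> = X" "space \<mu>0 = X0"
    using sets_eq_imp_space_eq[OF \<nu>(1)] sets_eq_imp_space_eq[OF \<mu>0(1)]
    by (simp_all add: space_restrict_space)
  have "emeasure \<mu>0 X0 \<le> vol S"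
    by (subst \<mu>0(2)) (auto simp: sets_rX0 intro!: emeasure_mono)
  then have \<mu>0fin: "emeasure \<mu>0 X0 < \<infinity>"
    using vol_subset_X_finite[OF SsubX] by (metis le_less_trans)
  define a where "a = enn2real (of_nat T * vol X - emeasure \<nu> X)"
  have a: "emeasure \<nu> X + ennreal a = of_nat T * vol X"
  proof -
    have "ennreal a = of_nat T * vol X - emeasure \<nu> X"
      unfolding a_def using TX by (intro ennreal_enn2real) (metis diff_le_self_ennreal le_less_trans infinity_ennreal_def)
    then show ?thesis using cost \<nu>X by (simp add: add_diff_inverse_ennreal)
  qed
  have flow: "emeasure (lebesgue_part X S) A + emeasure \<nu> A =
      pushforward X f \<nu> A + emeasure \<mu>0 (A \<inter> X0)" if A: "A \<in> sets (restrict_space borel X)" for A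
  proof -
    have [measurable]: "A \<in> sets borel" and AX: "A \<subseteq> X" using A sets_rX by auto
    \<comment> \<open>\<open>p k\<close> is the mass found in \<open>A\<close> at time \<open>k\<close>, arrivals at that time included.\<close>
    define p where "p k = vol {y \<in> S. k \<le> \<tau> y \<and> g k y \<in> A}" for k
    have split: "p k = vol {y \<in> S - R k. g k y \<in> A} + vol {y \<in> S \<inter> A. \<tau> y = k}" for k
    proof -
      have "{y \<in> S. k \<le> \<tau> y \<and> g k y \<in> A} = {y \<in> S - R k. g k y \<in> A} \<union> {y \<in> S \<inter> A. \<tau> y = k}"
      proof -
        have "k \<le> \<tau> y \<longleftrightarrow> y \<notin> R k \<or> \<tau> y = k" "\<tau> y = k \<Longrightarrow> g k y = y" if "y \<in> S" for y
          using s\<tau>(2)[of y] s\<tau>(3)[of y k] SX that by (auto simp: g_def)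
        then show ?thesis by auto
      qed
      moreover have "{y \<in> S - R k. g k y \<in> A} \<inter> {y \<in> S \<inter> A. \<tau> y = k} = {}"
        using s\<tau>(3) SX by blast
      ultimately show ?thesis
        unfolding p_def by (simp add: plus_emeasure)
    qed
    have "(\<Sum>k. vol {y \<in> S \<inter> A. \<tau> y = k}) = vol (\<Union>k. {y \<in> S \<inter> A. \<tau> y = k})"
      by (intro suminf_emeasure) (auto simp: disjoint_family_on_def)
    also have "(\<Union>k. {y \<in> S \<inter> A. \<tau> y = k}) = S \<inter> A" by auto
    finally have "emeasure (lebesgue_part X S) A + emeasure \<nu> A = (\<Sum>k. p k)"
      using A by (simp add: split suminf_add[symmetric] emeasure_lebesgue_part \<nu>(2) add.commute)
    also have "\<dots> = (\<Sum>k. p (Suc k)) + p 0"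
      using suminf_offset[of p 1] by simp
    also have "(\<Sum>k. p (Suc k)) = pushforward X f \<nu> A"
    proof -
      have "{x \<in> X. f x \<in> A} \<in> sets (restrict_space borel X)"
        unfolding sets_rX by auto
      moreover have "{y \<in> S. Suc k \<le> \<tau> y \<and> g (Suc k) y \<in> A} =
          {y \<in> S - R k. g k y \<in> {x \<in> X. f x \<in> A}}" for k
        using s\<tau>(3) SX gX by (auto simp: Suc_le_eq g_def)
      ultimately show ?thesis
        unfolding pushforward_def p_def by (simp add: \<nu>(2))
    qed
    also have "p 0 = emeasure \<mu>0 (A \<inter> X0)"
    proof -
      have "A \<inter> X0 \<in> sets (restrict_space borel X0)" by (simp add: sets_rX0)
      moreover have "{y \<in> S. 0 \<le> \<tau> y \<and> g 0 y \<in> A} = {y \<in> S. s y \<in> A \<inter> X0}"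
        using s\<tau>(1) SX by (auto simp: g_def)
      ultimately show ?thesis by (simp add: p_def \<mu>0(2))
    qed
    finally show ?thesis .
  qed
  have compl: "emeasure (lebesgue_part X S) A + emeasure (lebesgue_part X (X - S)) A =
      emeasure (lebesgue_part X X) A" if A: "A \<in> sets (restrict_space borel X)" for A
  proof -
    have [measurable]: "A \<in> sets borel" and AX: "A \<subseteq> X" using A sets_rX by auto
    have "vol (S \<inter> A) + vol ((X - S) \<inter> A) = vol ((S \<inter> A) \<union> ((X - S) \<inter> A))"
      by (intro plus_emeasure) auto
    also have "(S \<inter> A) \<union> ((X - S) \<inter> A) = X \<inter> A" using SsubX by auto
    finally show ?thesis using A by (simp add: emeasure_lebesgue_part)
  qed
  have "\<nu> \<in> borel_measures_on X" "\<mu>0 \<in> borel_measures_on X0"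
    using \<nu>(1) \<mu>0(1) \<nu>fin \<mu>0fin spaces
    unfolding borel_measures_on_def by (auto intro!: finite_measureI)
  moreover have "a \<ge> 0" by (simp add: a_def)
  ultimately have "lp_feasible X0 X f T \<mu>0 (lebesgue_part X S) (lebesgue_part X (X - S)) \<nu> a"
    unfolding lp_feasible_def using a flow compl by (auto intro!: lebesgue_part_in_borel_measures_on)
  then show ?thesis by blast
qed

section \<open>Bounds for feasible plans\<close>

text \<open>
  The arrival time integral of a feasible \<open>\<mu>\<close> respects the budget. Evaluate the flow equation on \<open>X - R k\<close>: there
  the source \<open>\<mu>0\<close> vanishes, and only points outside \<open>R (k - 1)\<close> are mapped there in one step, so
  \<open>\<mu> (X - R k) + \<nu> (X - R k) \<le> \<nu> (X - R (k - 1))\<close> for \<open>k \<ge> 1\<close>, while for \<open>k = 0\<close> the bound is \<open>\<nu> X\<close>.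
  These inequalities telescope to a bound by \<open>\<nu> X\<close>, which the budget dominates.
\<close>
lemma feasible_cost_bound:
  assumes "lp_feasible X0 X f T \<mu>0 \<mu> \<mu>h \<nu> a"
  shows "(\<Sum>k. emeasure \<mu> (X - R k)) \<le> of_nat T * vol X"
proof (rule suminf_le_const)
  fix n
  have sets_rX: "A \<in> sets (restrict_space borel X) \<longleftrightarrow> A \<subseteq> X \<and> A \<in> sets borel" for A
    by (simp add: sets_restrict_space_iff)
  have \<nu>: "sets \<nu> = sets (restrict_space borel X)"
    and a: "emeasure \<nu> X + ennreal a = of_nat T * vol X"
    and flow: "\<And>A. A \<in> sets (restrict_space borel X) \<Longrightarrow>
        emeasure \<mu> A + emeasure \<nu> A = pushforward X f \<nu> A + emeasure \<mu>0 (A \<inter> X0)"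
    using assms by (auto simp: lp_feasible_def borel_measures_on_def)
  have step: "emeasure \<mu> (X - R k) + emeasure \<nu> (X - R k) \<le>
      (case k of 0 \<Rightarrow> emeasure \<nu> X | Suc j \<Rightarrow> emeasure \<nu> (X - R j))" for k
  proof -
    have "X0 \<subseteq> R k" using reach_upto_mono[of 0 k] by (simp add: reach_upto_0)
    then have "(X - R k) \<inter> X0 = {}" by auto
    moreover have "X - R k \<in> sets (restrict_space borel X)" unfolding sets_rX by auto
    ultimately have "emeasure \<mu> (X - R k) + emeasure \<nu> (X - R k) = emeasure \<nu> {x \<in> X. f x \<in> X - R k}"
      using flow[of "X - R k"] by (simp add: pushforward_def)
    also have "\<dots> \<le> (case k of 0 \<Rightarrow> emeasure \<nu> X | Suc j \<Rightarrow> emeasure \<nu> (X - R j))"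
      using reach_upto_step by (auto split: nat.split intro!: emeasure_mono simp: \<nu> sets_rX)
    finally show ?thesis .
  qed
  have "(\<Sum>k<Suc n. emeasure \<mu> (X - R k)) + emeasure \<nu> (X - R n) \<le> emeasure \<nu> X" for n
  proof (induction n)
    case 0
    then show ?case using step[of 0] by simp
  next
    case (Suc n)
    have "(\<Sum>k<Suc (Suc n). emeasure \<mu> (X - R k)) + emeasure \<nu> (X - R (Suc n)) =
        (\<Sum>k<Suc n. emeasure \<mu> (X - R k)) + (emeasure \<mu> (X - R (Suc n)) + emeasure \<nu> (X - R (Suc n)))"
      by (simp add: add.assoc)
    also have "\<dots> \<le> (\<Sum>k<Suc n. emeasure \<mu> (X - R k)) + emeasure \<nu> (X - R n)"
      using step[of "Suc n"] by (intro add_left_mono) simp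
    also note Suc
    finally show ?case .
  qed
  from this[of n] have "(\<Sum>k<Suc n. emeasure \<mu> (X - R k)) \<le> emeasure \<nu> X"
    by (rule order_trans[rotated]) simp
  then have "(\<Sum>k<n. emeasure \<mu> (X - R k)) \<le> emeasure \<nu> X"
    by (rule order_trans[rotated]) simp
  also have "\<dots> \<le> of_nat T * vol X" unfolding a[symmetric] by simp
  finally show "(\<Sum>k<n. emeasure \<mu> (X - R k)) \<le> of_nat T * vol X" .
qed simp

lemma feasible_le_vol:
  assumes "lp_feasible X0 X f T \<mu>0 \<mu> \<mu>h \<nu> a" "A \<subseteq> X" "A \<in> sets borel"
  shows "emeasure \<mu> A \<le> vol A"
proof -
  have A: "A \<in> sets (restrict_space borel X)" using assms by (simp add: sets_restrict_space_iff)
  then have "emeasure \<mu> A + emeasure \<mu>h A = vol (X \<inter> A)"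
    using assms(1) by (simp add: lp_feasible_def emeasure_lebesgue_part)
  also have "X \<inter> A = A" using assms(2) by auto
  finally show ?thesis by (metis le_iff_add)
qed

lemma budget_finite: "of_nat T * vol X < \<infinity>"
  using vol_subset_X_finite[of X] by (simp add: ennreal_mult_less_top of_nat_less_top)

text \<open>
  Mass outside the reachable set would occur in every term of the convergent cost series.
\<close>
lemma feasible_null_outside_reach:
  assumes feas: "lp_feasible X0 X f T \<mu>0 \<mu> \<mu>h \<nu> a"
  shows "emeasure \<mu> (X - Xinf) = 0"
proof -
  have \<mu>: "sets \<mu> = sets (restrict_space borel X)"
    using feas by (auto simp: lp_feasible_def borel_measures_on_def)
  have le: "emeasure \<mu> (X - Xinf) \<le> emeasure \<mu> (X - R k)" for k
    using reach_upto_subset[of k] by (intro emeasure_mono) (auto simp: \<mu> sets_restrict_space_iff)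
  have "(\<Sum>k::nat. emeasure \<mu> (X - Xinf)) \<le> (\<Sum>k. emeasure \<mu> (X - R k))"
    using le by (intro suminf_le) auto
  also have "\<dots> < \<infinity>"
    using feasible_cost_bound[OF feas] budget_finite by (rule le_less_trans)
  finally have "(\<Sum>k::nat. emeasure \<mu> (X - Xinf)) \<noteq> \<infinity>" by simp
  moreover have "(\<Sum>k::nat. c) = c * \<infinity>" for c :: ennreal
    using nn_integral_count_space_nat[of "\<lambda>_. c"] by simp
  ultimately show ?thesis by (auto simp: ennreal_mult_top split: if_splits)
qed

lemma lp_value_eqI:
  assumes feas: "lp_feasible X0 X f T \<mu>0 (lebesgue_part X S) \<mu>h \<nu> a"
    and S: "S \<in> sets borel" "S \<subseteq> X"
    and ub: "\<And>\<mu>0 \<mu> \<mu>h \<nu> a. lp_feasible X0 X f T \<mu>0 \<mu> \<mu>h \<nu> a \<Longrightarrow> emeasure \<mu> X \<le> vol S"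
  shows "lp_value X0 X f T = vol S" "lp_optimal X0 X f T \<mu>0 (lebesgue_part X S) \<mu>h \<nu> a"
proof -
  have "X \<in> sets (restrict_space borel X)" by (simp add: sets_restrict_space_iff)
  then have eq: "emeasure (lebesgue_part X S) X = vol S"
    using S by (simp add: emeasure_lebesgue_part Int_absorb2)
  show val: "lp_value X0 X f T = vol S"
    unfolding lp_value_def
  proof (rule antisym)
    show "Sup {emeasure \<mu> X |\<mu>0 \<mu> \<mu>h \<nu> a. lp_feasible X0 X f T \<mu>0 \<mu> \<mu>h \<nu> a} \<le> vol S"
      using ub by (auto intro!: Sup_least)
    show "vol S \<le> Sup {emeasure \<mu> X |\<mu>0 \<mu> \<mu>h \<nu> a. lp_feasible X0 X f T \<mu>0 \<mu> \<mu>h \<nu> a}"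
      unfolding eq[symmetric] using feas by (intro Sup_upper) blast
  qed
  show "lp_optimal X0 X f T \<mu>0 (lebesgue_part X S) \<mu>h \<nu> a"
    using feas by (simp add: lp_optimal_def val eq)
qed

lemma feasible_mass_le_vol_reach:
  assumes feas: "lp_feasible X0 X f T \<mu>0 \<mu> \<mu>h \<nu> a"
  shows "emeasure \<mu> X \<le> vol Xinf"
proof -
  have \<mu>: "sets \<mu> = sets (restrict_space borel X)"
    using feas by (auto simp: lp_feasible_def borel_measures_on_def)
  have "emeasure \<mu> (Xinf \<union> (X - Xinf)) \<le> emeasure \<mu> Xinf + emeasure \<mu> (X - Xinf)"
    using reach_sub by (intro emeasure_subadditive) (auto simp: \<mu> sets_restrict_space_iff)
  moreover have "Xinf \<union> (X - Xinf) = X" using reach_sub by auto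
  ultimately show ?thesis
    using feasible_null_outside_reach[OF feas] feasible_le_vol[OF feas reach_sub borel_reach(4)] by simp
qed

section \<open>The greedy solution\<close>

text \<open>
  Arrival times on \<open>S\<close> are at most \<open>K + 1\<close>, those outside \<open>S\<close> at least \<open>K + 1\<close>, and the budget is
  exhausted, so \<open>S\<close> solves the fractional knapsack problem with values \<open>1\<close> and weights given by the
  arrival time. Optimality is proved by counting \<open>K + 1\<close> copies of the mass:
  \<open>(K + 1) * \<mu> X = (\<Sum>k\<le>K. \<mu> (R k)) + (\<Sum>k\<le>K. \<mu> (X - R k))\<close>. The first sum is at most the sum of the
  volumes of \<open>R k = S \<inter> R k\<close>, the second at most the budget, and for Lebesgue measure on \<open>S\<close> both
  bounds are attained.
\<close>
lemma greedy_set_optimal: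
  assumes S: "S \<in> sets borel" "R K \<subseteq> S" "S \<subseteq> R (Suc K)"
    and cost: "travel_cost S = of_nat T * vol X"
    and feas: "lp_feasible X0 X f T \<mu>0 \<mu> \<mu>h \<nu> a"
  shows "emeasure \<mu> X \<le> vol S"
proof -
  have \<mu>: "sets \<mu> = sets (restrict_space borel X)"
    using feas by (auto simp: lp_feasible_def borel_measures_on_def)
  have RX: "R k \<subseteq> X" for k using reach_upto_subset reach_sub by blast
  have SX: "S \<subseteq> X" using S(3) RX by blast
  have "of_nat (Suc K) * emeasure \<mu> X = (\<Sum>k<Suc K. emeasure \<mu> (R k) + emeasure \<mu> (X - R k))"
  proof -
    have "emeasure \<mu> (R k) + emeasure \<mu> (X - R k) = emeasure \<mu> X" for k
    proof -
      have "emeasure \<mu> (R k) + emeasure \<mu> (X - R k) = emeasure \<mu> (R k \<union> (X - R k))"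
        using RX by (intro plus_emeasure) (auto simp: \<mu> sets_restrict_space_iff)
      also have "R k \<union> (X - R k) = X" using RX by auto
      finally show ?thesis .
    qed
    then show ?thesis by simp
  qed
  also have "\<dots> = (\<Sum>k<Suc K. emeasure \<mu> (R k)) + (\<Sum>k<Suc K. emeasure \<mu> (X - R k))"
    by (rule sum.distrib)
  also have "\<dots> \<le> (\<Sum>k<Suc K. vol (R k)) + travel_cost S"
  proof (intro add_mono sum_mono)
    show "emeasure \<mu> (R k) \<le> vol (R k)" for k
      using feasible_le_vol[OF feas RX] by simp
    have "(\<Sum>k<Suc K. emeasure \<mu> (X - R k)) \<le> (\<Sum>k. emeasure \<mu> (X - R k))"
      by (intro sum_le_suminf) auto
    then show "(\<Sum>k<Suc K. emeasure \<mu> (X - R k)) \<le> travel_cost S"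
      using feasible_cost_bound[OF feas] cost by simp
  qed
  also have "travel_cost S = (\<Sum>k<Suc K. vol (S - R k))"
    unfolding travel_cost_def
  proof (rule suminf_finite)
    show "vol (S - R k) = 0" if "k \<notin> {..<Suc K}" for k
    proof -
      have "S - R k = {}" using S(3) reach_upto_mono[of "Suc K" k] that by auto
      then show ?thesis by (simp only: emeasure_empty)
    qed
  qed simp
  also have "(\<Sum>k<Suc K. vol (R k)) + (\<Sum>k<Suc K. vol (S - R k)) = (\<Sum>k<Suc K. vol S)"
    unfolding sum.distrib[symmetric]
  proof (rule sum.cong)
    fix k assume "k \<in> {..<Suc K}"
    then have sub: "R k \<subseteq> S" using S(2) reach_upto_mono[of k K] by auto
    have "vol (R k) + vol (S - R k) = vol (R k \<union> (S - R k))"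
      using S(1) by (intro plus_emeasure) auto
    also have "R k \<union> (S - R k) = S" using sub by auto
    finally show "vol (R k) + vol (S - R k) = vol S" .
  qed simp
  also have "\<dots> = of_nat (Suc K) * vol S" by simp
  finally have "of_nat (Suc K) * emeasure \<mu> X \<le> of_nat (Suc K) * vol S" .
  then show ?thesis
    by (simp add: ennreal_mult_le_mult_iff del: of_nat_Suc)
qed

text \<open>
  Points of \<open>R T\<close> arrive by time \<open>T\<close>. This is why the budget \<open>T * vol X\<close> always pays for \<open>R T\<close>.
\<close>
lemma travel_cost_reach_upto_le: "travel_cost (R T) \<le> of_nat T * vol X"
proof -
  have "travel_cost (R T) = (\<Sum>k<T. vol (R T - R k))"
    unfolding travel_cost_def
  proof (rule suminf_finite)
    show "vol (R T - R k) = 0" if "k \<notin> {..<T}" for k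
      using reach_upto_mono[of T k] that by (simp add: Diff_eq_empty_iff[THEN iffD2])
  qed simp
  also have "\<dots> \<le> (\<Sum>k<T. vol X)"
    using reach_upto_subset[of T] reach_sub by (intro sum_mono emeasure_mono) auto
  finally show ?thesis by simp
qed

lemma travel_cost_mono:
  assumes "S \<subseteq> S'" "S' \<in> sets borel"
  shows "travel_cost S \<le> travel_cost S'"
  unfolding travel_cost_def using assms by (intro suminf_le emeasure_mono) auto

text \<open>
  Each partial sum of the cost series passes to the limit by continuity of the measure from below.
\<close>
lemma travel_cost_reach_set_le:
  assumes B: "\<And>K. travel_cost (R K) \<le> B"
  shows "travel_cost Xinf \<le> B"
  unfolding travel_cost_def
proof (rule suminf_le_const)
  fix n
  have "(\<lambda>K. vol (R K - R k)) \<longlonglongrightarrow> vol (\<Union>K. R K - R k)" for k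
    using reach_upto_mono by (intro Lim_emeasure_incseq) (auto simp: incseq_def)
  moreover have "(\<Union>K. R K - R k) = Xinf - R k" for k by (auto simp: reach_set_def)
  ultimately have lim: "(\<lambda>K. \<Sum>k<n. vol (R K - R k)) \<longlonglongrightarrow> (\<Sum>k<n. vol (Xinf - R k))"
    by (intro tendsto_sum) simp
  have "(\<Sum>k<n. vol (R K - R k)) \<le> B" for K
  proof -
    have "(\<Sum>k<n. vol (R K - R k)) \<le> travel_cost (R K)"
      unfolding travel_cost_def by (intro sum_le_suminf) auto
    with B show ?thesis by (rule order_trans[rotated])
  qed
  with lim show "(\<Sum>k<n. vol (Xinf - R k)) \<le> B"
    by (intro LIMSEQ_le_const2) auto
qed simp

text \<open>
  If the budget does not pay for the whole reachable set, let \<open>R K\<close> be the last of the increasing sets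
  \<open>R k\<close> that it pays for. Adding a unit of volume from the layer \<open>R (K + 1) - R K\<close> costs \<open>K + 1\<close>, and since
  Lebesgue measure has no atoms, a part of this layer uses up the rest of the budget exactly.
\<close>
lemma exists_greedy_set:
  assumes cost: "of_nat T * vol X < travel_cost Xinf"
  shows "\<exists>S K. S \<in> sets borel \<and> R K \<subseteq> S \<and> S \<subseteq> R (Suc K) \<and> T \<le> K \<and>
           travel_cost S = of_nat T * vol X"
proof -
  define B where "B = of_nat T * vol X"
  have Bfin: "B < \<infinity>" unfolding B_def by (rule budget_finite)
  have "\<exists>K. B < travel_cost (R K)"
    using travel_cost_reach_set_le[of B] cost unfolding B_def by (meson not_le)
  then obtain K' where K': "B < travel_cost (R K')" "\<And>k. k < K' \<Longrightarrow> travel_cost (R k) \<le> B"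
    using exists_least_iff[of "\<lambda>K. B < travel_cost (R K)"] by (auto simp: not_less)
  have "T < K'"
  proof (rule ccontr)
    assume "\<not> T < K'"
    then have "travel_cost (R K') \<le> travel_cost (R T)"
      by (intro travel_cost_mono reach_upto_mono) auto
    also have "\<dots> \<le> B" unfolding B_def by (rule travel_cost_reach_upto_le)
    finally show False using K'(1) by simp
  qed
  then obtain K where K: "K' = Suc K" "T \<le> K" by (cases K') auto
  have lo: "travel_cost (R K) \<le> B" using K' K by simp
  have cost_eq: "travel_cost (R K \<union> Z) = travel_cost (R K) + of_nat (Suc K) * vol Z"
    if Z: "Z \<in> sets borel" "Z \<subseteq> R (Suc K) - R K" for Z
  proof -
    have "vol ((R K \<union> Z) - R k) = vol (R K - R k) + (if k < Suc K then vol Z else 0)" for k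
    proof (cases "k < Suc K")
      case True
      have "vol (R K - R k) + vol Z = vol ((R K - R k) \<union> Z)"
        using Z by (intro plus_emeasure) auto
      also have "(R K - R k) \<union> Z = (R K \<union> Z) - R k"
        using Z(2) reach_upto_mono[of k K] True by auto
      finally show ?thesis using True by simp
    next
      case False
      then have "(R K \<union> Z) - R k = R K - R k"
        using Z(2) reach_upto_mono[of "Suc K" k] by auto
      with False show ?thesis by simp
    qed
    then have "travel_cost (R K \<union> Z) =
        travel_cost (R K) + (\<Sum>k. if k < Suc K then vol Z else 0)"
      unfolding travel_cost_def by (simp add: suminf_add)
    also have "(\<Sum>k. if k < Suc K then vol Z else 0) = (\<Sum>k<Suc K. if k < Suc K then vol Z else 0)"
      by (rule suminf_finite) auto
    also have "\<dots> = of_nat (Suc K) * vol Z" by (subst sum.cong[OF refl, of _ _ "\<lambda>_. vol Z"]) auto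
    finally show ?thesis .
  qed
  \<comment> \<open>The volume that the remaining budget pays for at price \<open>K + 1\<close>.\<close>
  define v where "v = (B - travel_cost (R K)) / of_nat (Suc K)"
  have v: "of_nat (Suc K) * v = B - travel_cost (R K)"
    unfolding v_def ennreal_times_divide
    by (subst mult.commute) (simp add: ennreal_mult_divide_eq del: of_nat_Suc)
  have "R K \<union> (R (Suc K) - R K) = R (Suc K)" using reach_upto_mono[of K "Suc K"] by auto
  then have "B < travel_cost (R K) + of_nat (Suc K) * vol (R (Suc K) - R K)"
    using K' K cost_eq[of "R (Suc K) - R K"] by simp
  then have "B - travel_cost (R K) \<le> of_nat (Suc K) * vol (R (Suc K) - R K)"
    using Bfin by (auto simp: ennreal_minus_le_iff less_imp_le simp del: of_nat_Suc)
  then have "v \<le> vol (R (Suc K) - R K)"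
    unfolding v[symmetric] by (simp add: ennreal_mult_le_mult_iff del: of_nat_Suc)
  moreover have "bounded (R (Suc K) - R K)"
    using compact_reach_upto compact_imp_bounded bounded_subset by blast
  ultimately obtain Z where Z: "Z \<in> sets borel" "Z \<subseteq> R (Suc K) - R K" "vol Z = v"
    using exists_borel_subset_of_volume[of "R (Suc K) - R K" v] by auto
  have "travel_cost (R K \<union> Z) = B"
    using cost_eq[OF Z(1,2)] Z(3) v lo by (simp add: add_diff_inverse_ennreal)
  then show ?thesis
    using Z K reach_upto_mono[of K "Suc K"] unfolding B_def
    by (intro exI[of _ "R K \<union> Z"] exI[of _ K]) auto
qed

section \<open>Budgets that reach everything\<close>

text \<open>
  A reachable point outside \<open>R k\<close> is first reached at some time \<open>t > k\<close>, so the layer first reached at time \<open>t\<close>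
  contributes at most \<open>t\<close> times to the cost series.
\<close>
lemma travel_cost_le_weighted_volumes:
  "travel_cost Xinf \<le> (\<Sum>t. of_nat t * vol (first_reached X0 f t))"
  unfolding travel_cost_def
proof (rule suminf_le_const)
  fix n
  have [measurable]: "first_reached X0 f t \<in> sets borel" for t
    using borel_compact[OF compact_iterate_image] by (cases t) (auto simp del: funpow.simps)
  have in_first: "\<exists>t. x \<in> first_reached X0 f t \<and> (\<forall>k. x \<notin> R k \<longrightarrow> k < t)" if x: "x \<in> Xinf" for x
  proof -
    define t where "t = (LEAST t. x \<in> R t)"
    obtain u where "x \<in> R u" using x unfolding reach_set_def by blast
    then have t: "x \<in> R t" unfolding t_def by (rule LeastI)
    have least: "x \<notin> R k" if "k < t" for k
      using that unfolding t_def by (rule not_less_Least)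
    have "x \<in> first_reached X0 f t"
    proof (cases t)
      case 0
      then show ?thesis using t by (simp add: reach_upto_0)
    next
      case (Suc j)
      then have "x \<notin> R j" using least by simp
      moreover have "R t = R j \<union> (f ^^ t) ` X0"
        unfolding reach_upto_def Suc by (simp add: atMost_Suc Un_commute)
      ultimately show ?thesis using t Suc by (simp del: funpow.simps)
    qed
    moreover have "\<forall>k. x \<notin> R k \<longrightarrow> k < t"
      using t reach_upto_mono by (meson not_less subsetD)
    ultimately show ?thesis by blast
  qed
  have "vol (Xinf - R k) \<le> (\<Sum>t. if k < t then vol (first_reached X0 f t) else 0)" for k
  proof -
    have "vol (Xinf - R k) \<le> vol (\<Union>t. if k < t then first_reached X0 f t else {})"
    proof (rule emeasure_mono)
      show "Xinf - R k \<subseteq> (\<Union>t. if k < t then first_reached X0 f t else {})"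
      proof
        fix x assume "x \<in> Xinf - R k"
        then obtain t where "x \<in> first_reached X0 f t" "k < t" using in_first by blast
        then show "x \<in> (\<Union>t. if k < t then first_reached X0 f t else {})"
          by (intro UN_I[of t]) auto
      qed
    qed auto
    also have "\<dots> \<le> (\<Sum>t. vol (if k < t then first_reached X0 f t else {}))"
      by (intro emeasure_subadditive_countably) auto
    also have "\<dots> = (\<Sum>t. if k < t then vol (first_reached X0 f t) else 0)"
      by (intro suminf_cong) auto
    finally show ?thesis .
  qed
  then have "(\<Sum>k<n. vol (Xinf - R k)) \<le>
      (\<Sum>k<n. \<Sum>t. if k < t then vol (first_reached X0 f t) else 0)"
    by (intro sum_mono)
  also have "\<dots> = (\<Sum>t. \<Sum>k<n. if k < t then vol (first_reached X0 f t) else 0)"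
    by (intro suminf_sum[symmetric]) auto
  also have "\<dots> \<le> (\<Sum>t. of_nat t * vol (first_reached X0 f t))"
  proof (intro suminf_le)
    fix t
    have "(\<Sum>k<n. if k < t then vol (first_reached X0 f t) else 0) =
        (\<Sum>k\<in>{..<n} \<inter> {..<t}. vol (first_reached X0 f t))"
      by (subst sum.inter_restrict) auto
    also have "\<dots> \<le> (\<Sum>k<t. vol (first_reached X0 f t))"
      by (intro sum_mono2) auto
    also have "\<dots> = of_nat t * vol (first_reached X0 f t)" by simp
    finally show "(\<Sum>k<n. if k < t then vol (first_reached X0 f t) else 0) \<le>
        of_nat t * vol (first_reached X0 f t)" .
  qed auto
  finally show "(\<Sum>k<n. vol (Xinf - R k)) \<le> (\<Sum>t. of_nat t * vol (first_reached X0 f t))" .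
qed simp

text \<open>
  With a sufficient budget, Lebesgue measure on the reachable set is feasible. Any other optimal \<open>\<mu>\<close>
  is bounded by this finite measure and has the same mass, hence equals it; then \<open>\<mu>h\<close> is determined as
  the complementary part of Lebesgue measure on \<open>X\<close>.
\<close>
lemma optimal_mu_unique:
  assumes cost: "travel_cost Xinf \<le> of_nat T * vol X"
  shows "lp_value X0 X f T = vol Xinf"
    and "lp_optimal_mu X0 X f T = {(lebesgue_part X Xinf, lebesgue_part X (X - Xinf))}"
proof -
  have sets_rX: "A \<in> sets (restrict_space borel X) \<longleftrightarrow> A \<subseteq> X \<and> A \<in> sets borel" for A
    by (simp add: sets_restrict_space_iff)
  obtain \<mu>0 \<nu> a where
    feas: "lp_feasible X0 X f T \<mu>0 (lebesgue_part X Xinf) (lebesgue_part X (X - Xinf)) \<nu> a"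
    using feasible_of_cost[OF borel_reach(4) subset_refl cost] by blast
  note opt = lp_value_eqI[OF feas borel_reach(4) reach_sub feasible_mass_le_vol_reach]
  show val: "lp_value X0 X f T = vol Xinf" by (rule opt(1))
  have "\<mu> = lebesgue_part X Xinf \<and> \<mu>h = lebesgue_part X (X - Xinf)"
    if "lp_optimal X0 X f T \<mu>0 \<mu> \<mu>h \<nu> a" for \<mu>0 \<mu> \<mu>h \<nu> a
  proof -
    have feas: "lp_feasible X0 X f T \<mu>0 \<mu> \<mu>h \<nu> a" and mass: "emeasure \<mu> X = vol Xinf"
      using that by (auto simp: lp_optimal_def val)
    have \<mu>: "sets \<mu> = sets (restrict_space borel X)" and \<mu>h: "sets \<mu>h = sets (restrict_space borel X)"
      and sum: "\<And>A. A \<in> sets (restrict_space borel X) \<Longrightarrow>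
          emeasure \<mu> A + emeasure \<mu>h A = vol (X \<inter> A)"
      using feas by (auto simp: lp_feasible_def borel_measures_on_def emeasure_lebesgue_part)
    have eq: "emeasure \<mu> A = vol (Xinf \<inter> A)" if A: "A \<in> sets (restrict_space borel X)" for A
    proof -
      have A': "A \<subseteq> X" "A \<in> sets borel" using A sets_rX by auto
      have le: "emeasure \<mu> C \<le> vol (Xinf \<inter> C)" if C: "C \<subseteq> X" "C \<in> sets borel" for C
      proof -
        have "emeasure \<mu> C \<le> emeasure \<mu> ((Xinf \<inter> C) \<union> (X - Xinf))"
          using C reach_sub by (intro emeasure_mono) (auto simp: \<mu> sets_rX)
        also have "\<dots> \<le> emeasure \<mu> (Xinf \<inter> C) + emeasure \<mu> (X - Xinf)"
          using C by (intro emeasure_subadditive) (auto simp: \<mu> sets_rX)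
        also have "\<dots> \<le> vol (Xinf \<inter> C)"
          using feasible_null_outside_reach[OF feas] feasible_le_vol[OF feas, of "Xinf \<inter> C"] C by auto
        finally show ?thesis .
      qed
      have "vol (Xinf \<inter> A) + vol (Xinf \<inter> (X - A)) = vol ((Xinf \<inter> A) \<union> (Xinf \<inter> (X - A)))"
        using A' by (intro plus_emeasure) auto
      also have "(Xinf \<inter> A) \<union> (Xinf \<inter> (X - A)) = Xinf" using reach_sub by auto
      also have "vol Xinf = emeasure \<mu> (A \<union> (X - A))" using mass A' by (simp add: Un_absorb1)
      also have "\<dots> = emeasure \<mu> A + emeasure \<mu> (X - A)"
        using A' by (intro plus_emeasure[symmetric]) (auto simp: \<mu> sets_rX)
      also have "\<dots> \<le> emeasure \<mu> A + vol (Xinf \<inter> (X - A))"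
        using le[of "X - A"] A' by (intro add_left_mono) auto
      finally have "vol (Xinf \<inter> (X - A)) + vol (Xinf \<inter> A) \<le> vol (Xinf \<inter> (X - A)) + emeasure \<mu> A"
        by (simp add: add.commute)
      moreover have "vol (Xinf \<inter> (X - A)) < \<infinity>" by (rule vol_subset_X_finite) auto
      ultimately have "vol (Xinf \<inter> A) \<le> emeasure \<mu> A"
        unfolding ennreal_add_left_cancel_le by (metis infinity_ennreal_def less_irrefl)
      with le[OF A'] show ?thesis by (rule antisym)
    qed
    have eqh: "emeasure \<mu>h A = vol ((X - Xinf) \<inter> A)" if A: "A \<in> sets (restrict_space borel X)" for A
    proof -
      have A': "A \<subseteq> X" "A \<in> sets borel" using A sets_rX by auto
      have "vol (Xinf \<inter> A) + vol ((X - Xinf) \<inter> A) = vol ((Xinf \<inter> A) \<union> ((X - Xinf) \<inter> A))"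
        using A' by (intro plus_emeasure) auto
      also have "(Xinf \<inter> A) \<union> ((X - Xinf) \<inter> A) = X \<inter> A" using reach_sub by auto
      finally have "vol (Xinf \<inter> A) + emeasure \<mu>h A = vol (Xinf \<inter> A) + vol ((X - Xinf) \<inter> A)"
        using sum[OF A] eq[OF A] by simp
      moreover have "vol (Xinf \<inter> A) < \<infinity>" using A' by (intro vol_subset_X_finite) auto
      ultimately show ?thesis
        unfolding ennreal_add_left_cancel by (metis infinity_ennreal_def less_irrefl)
    qed
    show ?thesis
      using eq eqh by (auto intro!: measure_eqI simp: \<mu> \<mu>h emeasure_lebesgue_part)
  qed
  moreover have "lp_optimal X0 X f T \<mu>0 (lebesgue_part X Xinf) (lebesgue_part X (X - Xinf)) \<nu> a"
    by (rule opt(2))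
  ultimately show "lp_optimal_mu X0 X f T = {(lebesgue_part X Xinf, lebesgue_part X (X - Xinf))}"
    unfolding lp_optimal_mu_def by blast
qed

lemma budget_eventually_suffices:
  assumes fin: "travel_cost Xinf < \<infinity>"
  shows "\<exists>T0. \<forall>T\<ge>T0. travel_cost Xinf \<le> of_nat T * vol X"
proof (cases "vol X = 0")
  case True
  have "vol (Xinf - R k) \<le> vol X" for k
    using reach_sub by (intro emeasure_mono) auto
  with True have "travel_cost Xinf = 0" by (simp add: travel_cost_def)
  then show ?thesis by simp
next
  case False
  then have "travel_cost Xinf / vol X < top"
    using fin by (auto simp: less_top[symmetric] ennreal_divide_eq_top_iff)
  then obtain T0 :: nat where T0: "travel_cost Xinf / vol X \<le> of_nat T0"
    using ennreal_Ex_less_of_nat less_imp_le by blast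
  have "travel_cost Xinf \<le> of_nat T * vol X" if "T \<ge> T0" for T
  proof -
    have "travel_cost Xinf = travel_cost Xinf / vol X * vol X"
      using False vol_subset_X_finite[of X]
      by (simp add: ennreal_divide_times ennreal_divide_self)
    also have "\<dots> \<le> of_nat T * vol X"
      using T0 that by (intro mult_right_mono) (auto intro: order_trans)
    finally show ?thesis .
  qed
  then show ?thesis by blast
qed

section \<open>Optimal solutions of the linear program\<close>

text \<open>
  With a sufficient budget, \<open>closure Xinf\<close> may replace \<open>Xinf\<close> because the two differ by a null set;
  otherwise the greedy set is taken.
\<close>
lemma exists_optimal_set:
  assumes vol_closure: "vol Xinf = vol (closure Xinf)"
  shows "\<exists>S. S \<in> sets borel \<and> R T \<subseteq> S \<and> S \<subseteq> closure Xinf \<and> vol S = lp_value X0 X f T \<and>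
      (\<exists>\<mu>0 \<mu>h \<nu> a. lp_optimal X0 X f T \<mu>0 (lebesgue_part X S) \<mu>h \<nu> a) \<and>
      (travel_cost Xinf \<le> of_nat T * vol X \<longrightarrow> S = closure Xinf)"
proof (cases "travel_cost Xinf \<le> of_nat T * vol X")
  case True
  have "(lebesgue_part X Xinf, lebesgue_part X (X - Xinf)) \<in> lp_optimal_mu X0 X f T"
    using optimal_mu_unique(2)[OF True] by simp
  moreover have "lebesgue_part X Xinf = lebesgue_part X (closure Xinf)"
    using vol_closure closure_subset vol_subset_X_finite[OF reach_sub]
    by (intro lebesgue_part_eqI) auto
  ultimately have "\<exists>\<mu>0 \<mu>h \<nu> a. lp_optimal X0 X f T \<mu>0 (lebesgue_part X (closure Xinf)) \<mu>h \<nu> a"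
    unfolding lp_optimal_mu_def by auto
  moreover have "R T \<subseteq> closure Xinf"
    using reach_upto_subset closure_subset by blast
  moreover have "vol (closure Xinf) = lp_value X0 X f T"
    using optimal_mu_unique(1)[OF True] vol_closure by simp
  ultimately show ?thesis by (intro exI[of _ "closure Xinf"]) auto
next
  case False
  then obtain S K where S: "S \<in> sets borel" "R K \<subseteq> S" "S \<subseteq> R (Suc K)" "T \<le> K"
    "travel_cost S = of_nat T * vol X"
    using exists_greedy_set[of T] by (auto simp: not_le)
  have SX: "S \<subseteq> Xinf" using S(3) reach_upto_subset by blast
  then have SX': "S \<subseteq> X" using reach_sub by blast
  obtain \<mu>0 \<nu> a where feas:
    "lp_feasible X0 X f T \<mu>0 (lebesgue_part X S) (lebesgue_part X (X - S)) \<nu> a"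
    using feasible_of_cost[OF S(1) SX] S(5) by (metis order_refl)
  have ub: "emeasure \<mu> X \<le> vol S" if "lp_feasible X0 X f T \<mu>0 \<mu> \<mu>h \<nu> a" for \<mu>0 \<mu> \<mu>h \<nu> a
    by (rule greedy_set_optimal[OF S(1-3,5) that])
  have val: "lp_value X0 X f T = vol S"
    by (rule lp_value_eqI(1)[OF feas S(1) SX']) (rule ub)
  have opt: "lp_optimal X0 X f T \<mu>0 (lebesgue_part X S) (lebesgue_part X (X - S)) \<nu> a"
    by (rule lp_value_eqI(2)[OF feas S(1) SX']) (rule ub)
  have "R T \<subseteq> S" using reach_upto_mono[OF S(4)] S(2) by blast
  moreover have "S \<subseteq> closure Xinf" using SX closure_subset by blast
  ultimately show ?thesis using val opt S(1) False by (intro exI[of _ S] conjI) (blast | simp)+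
qed

end

theorem lemma3p5:
  fixes g0 g :: "nat \<Rightarrow> real ^ 'n \<Rightarrow> real"
    and f :: "real ^ 'n \<Rightarrow> real ^ 'n"
    and m0 m :: nat
    and X0 X Xinf :: "(real ^ 'n) set"
  assumes g0_poly: "\<And>j. j \<in> {1..m0} \<Longrightarrow> real_polynomial_function (g0 j)"
    and g_poly: "\<And>j. j \<in> {1..m} \<Longrightarrow> real_polynomial_function (g j)"
    and f_poly: "polynomial_function f"
    and X0_def: "X0 = semialg_set g0 m0"
    and X_def: "X = semialg_set g m"
    and X0_compact: "compact X0"
    and X_compact: "compact X"
    and Xinf_def: "Xinf = reach_set X0 f"
    and Xinf_sub: "Xinf \<subseteq> X"
    and vol_closure: "vol Xinf = vol (closure Xinf)"
    and ball0: "\<exists>N0::int. \<exists>j\<in>{1..m0}. \<forall>x. g0 j x = of_int N0 - (norm x)\<^sup>2"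
    and ball: "\<exists>N::int. \<exists>j\<in>{1..m}. \<forall>x. g j x = of_int N - (norm x)\<^sup>2"
  shows "\<exists>S :: nat \<Rightarrow> (real ^ 'n) set.
    (\<forall>T\<ge>1.
       S T \<in> sets borel \<and> reach_upto X0 f T \<subseteq> S T \<and> S T \<subseteq> closure Xinf \<and>
       vol (S T) = lp_value X0 X f T \<and>
       (\<exists>\<mu>0 \<mu> \<mu>h \<nu> a. lp_optimal X0 X f T \<mu>0 \<mu> \<mu>h \<nu> a \<and> \<mu> = lebesgue_part X (S T))) \<and>
    ((\<Sum>t. of_nat t * vol (first_reached X0 f t)) < \<infinity> \<longrightarrow>
       (\<exists>T0. \<forall>T\<ge>T0.
          S T = closure Xinf \<and>
          lp_optimal_mu X0 X f T = {(lebesgue_part X Xinf, lebesgue_part X (X - Xinf))} \<and>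
          lp_value X0 X f T = vol Xinf))"
proof -
  interpret reachability X0 X f
    using X0_compact X_compact Xinf_sub Xinf_def continuous_on_polymonial_function[OF f_poly]
    by unfold_locales auto
  obtain S where S: "\<And>T. S T \<in> sets borel" "\<And>T. reach_upto X0 f T \<subseteq> S T"
      "\<And>T. S T \<subseteq> closure Xinf" "\<And>T. vol (S T) = lp_value X0 X f T"
      "\<And>T. \<exists>\<mu>0 \<mu>h \<nu> a. lp_optimal X0 X f T \<mu>0 (lebesgue_part X (S T)) \<mu>h \<nu> a"
      "\<And>T. travel_cost Xinf \<le> of_nat T * vol X \<Longrightarrow> S T = closure Xinf"
    using exists_optimal_set vol_closure unfolding Xinf_def by metis
  have optimal: "\<exists>\<mu>0 \<mu> \<mu>h \<nu> a. lp_optimal X0 X f T \<mu>0 \<mu> \<mu>h \<nu> a \<and> \<mu> = lebesgue_part X (S T)" for T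
    using S(5)[of T] by blast
  have eventually: "\<exists>T0. \<forall>T\<ge>T0. S T = closure Xinf \<and>
      lp_optimal_mu X0 X f T = {(lebesgue_part X Xinf, lebesgue_part X (X - Xinf))} \<and>
      lp_value X0 X f T = vol Xinf"
    if "(\<Sum>t. of_nat t * vol (first_reached X0 f t)) < \<infinity>"
  proof -
    have "travel_cost Xinf < \<infinity>"
      using travel_cost_le_weighted_volumes that unfolding Xinf_def by (rule le_less_trans)
    then obtain T0 where "\<And>T. T \<ge> T0 \<Longrightarrow> travel_cost Xinf \<le> of_nat T * vol X"
      using budget_eventually_suffices unfolding Xinf_def by blast
    then show ?thesis
      using S(6) optimal_mu_unique unfolding Xinf_def by blast
  qed
  show ?thesis
    by (rule exI[of _ S]) (intro conjI allI impI S(1-4) optimal eventually)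
qed

end
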